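(* Let $X$ be a compact extremally disconnected space that can be embedded in $\omega^*$ as a weak $P$-set. Moreover, assume that there exists a proper clopen subspace of $X$ homeomorphic to $X$. Then there is a non-reversible filter $\mathcal{F}$ on $\omega$ such that $K_{\mathcal{F}}$ is a weak $P$-set of $\omega^*$ homeomorphic to $X$.
   Context: Spaces are Hausdorff. A space is extremally disconnected if the closure of every open subset is open. $\beta\omega$ is the Stone space of all ultrafilters on $\omega$ and $\omega^*=\beta\omega\setminus\omega$ is the subspace of free ultrafilters. A closed set $K\subset\omega^*$ is a weak $P$-set of $\omega^*$ if for every countable $D\subset\omega^*\setminus K$ the closure of $D$ in $\omega^*$ is disjoint from $K$; a space embeds in $\omega^*$ as a weak $P$-set if there is an embedding of it into $\omega^*$ whose image is a weak $P$-set of $\omega^*$. A filter on $\omega$ is a nonempty family of subsets of $\omega$ closed under supersets and finite intersections; all filters on $\omega$ are assumed to contain the Fréchet filter of all cofinite subsets of $\omega$. For a filter $\mathcal{F}$ on $\omega$, $\xi(\mathcal{F})$ is the topological space with underlying set $\omega\cup\{\mathcal{F}\}$ in which every point of $\omega$ is isolated and the neighborhoods of the point $\mathcal{F}$ are the sets $\{\mathcal{F}\}\cup A$ with $A\in\mathcal{F}$. A topological space is reversible if every continuous bijection of the space onto itself is a homeomorphism. A filter $\mathcal{F}$ is reversible if the space $\xi(\mathcal{F})$ is reversible, and non-reversible otherwise. $K_{\mathcal{F}}=\{p\in\beta\omega:\mathcal{F}\subset p\}$, a closed subset of $\omega^*$, considered with the subspace topology. *)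

theory Defs
  imports "HOL-Analysis.Analysis"
begin

text \<open>
  A filter on \<open>\<omega>\<close> is a value \<open>F :: nat filter\<close>, and \<open>A \<in> F\<close> is rendered as
  \<open>eventually (\<lambda>n. n \<in> A) F\<close>. The order of the library is reverse inclusion: \<open>p \<le> F\<close> says
  that \<open>F\<close> is contained in \<open>p\<close>; in particular \<open>F \<le> cofinite\<close> says that \<open>F\<close> contains the
  Frechet filter. The type includes the improper filter \<open>bot\<close>.
\<close>

definition ultrafilter :: "'a filter \<Rightarrow> bool" where
  "ultrafilter p \<longleftrightarrow>
     p \<noteq> bot \<and> (\<forall>A. eventually (\<lambda>x. x \<in> A) p \<or> eventually (\<lambda>x. x \<notin> A) p)"

definition beta_omega :: "nat filter topology" where
  "beta_omega =
     topology_generated_by (range (\<lambda>A. {p. ultrafilter p \<and> eventually (\<lambda>n. n \<in> A) p}))"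

lemma topspace_beta_omega: "topspace beta_omega = {p. ultrafilter p}"
proof -
  have "ultrafilter p \<and> eventually (\<lambda>n. n \<in> UNIV) p" if "ultrafilter p" for p :: "nat filter"
    using that by simp
  then show ?thesis
    unfolding beta_omega_def topology_generated_by_topspace by blast
qed

text \<open>The point \<open>n\<close> of \<open>\<omega>\<close> is identified with the ultrafilter \<open>principal {n}\<close>.\<close>

definition omega_star :: "nat filter topology" where
  "omega_star = subtopology beta_omega (topspace beta_omega - range (\<lambda>n. principal {n}))"

definition K_filter :: "nat filter \<Rightarrow> nat filter set" where
  "K_filter F = {p \<in> topspace beta_omega. p \<le> F}"

definition weak_P_set :: "'a topology \<Rightarrow> 'a set \<Rightarrow> bool" where
  "weak_P_set X K \<longleftrightarrow>
     closedin X K \<and>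
     (\<forall>D. countable D \<and> D \<subseteq> topspace X - K \<longrightarrow> (X closure_of D) \<inter> K = {})"

definition embeds_as_weak_P_set :: "'a topology \<Rightarrow> 'b topology \<Rightarrow> bool" where
  "embeds_as_weak_P_set X Y \<longleftrightarrow> (\<exists>f. embedding_map X Y f \<and> weak_P_set Y (f ` topspace X))"

definition extremally_disconnected_space :: "'a topology \<Rightarrow> bool" where
  "extremally_disconnected_space X \<longleftrightarrow> (\<forall>U. openin X U \<longrightarrow> openin X (X closure_of U))"

definition reversible_space :: "'a topology \<Rightarrow> bool" where
  "reversible_space X \<longleftrightarrow>
     (\<forall>f. continuous_map X X f \<and> bij_betw f (topspace X) (topspace X) \<longrightarrow> homeomorphic_map X X f)"

text \<open>
  The underlying set of \<open>\<xi>(F)\<close> is the type \<open>nat option\<close>: \<open>Some n\<close> is the point \<open>n\<close> of \<open>\<omega>\<close>, and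
  \<open>None\<close> is the added point \<open>F\<close>.
\<close>

definition xi_space :: "nat filter \<Rightarrow> nat option topology" where
  "xi_space F = topology (\<lambda>U. None \<in> U \<longrightarrow> eventually (\<lambda>n. Some n \<in> U) F)"

lemma openin_xi_space:
  "openin (xi_space F) U \<longleftrightarrow> (None \<in> U \<longrightarrow> eventually (\<lambda>n. Some n \<in> U) F)"
proof -
  have "istopology (\<lambda>U. None \<in> U \<longrightarrow> eventually (\<lambda>n. Some n \<in> U) F)"
    unfolding istopology_def
  proof (intro conjI allI impI)
    fix S T :: "nat option set"
    assume "None \<in> S \<longrightarrow> eventually (\<lambda>n. Some n \<in> S) F"
      and "None \<in> T \<longrightarrow> eventually (\<lambda>n. Some n \<in> T) F" and "None \<in> S \<inter> T"
    then show "eventually (\<lambda>n. Some n \<in> S \<inter> T) F"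
      by (auto intro: eventually_conj)
  next
    fix \<K> :: "nat option set set"
    assume K: "\<forall>S\<in>\<K>. None \<in> S \<longrightarrow> eventually (\<lambda>n. Some n \<in> S) F" and "None \<in> \<Union>\<K>"
    then obtain S where "S \<in> \<K>" "eventually (\<lambda>n. Some n \<in> S) F"
      by blast
    then show "eventually (\<lambda>n. Some n \<in> \<Union>\<K>) F"
      by (auto elim: eventually_mono)
  qed
  then show ?thesis
    by (simp add: xi_space_def)
qed

lemma topspace_xi_space: "topspace (xi_space F) = UNIV"
  by (metis UNIV_I always_eventually openin_subset openin_xi_space top.extremum_uniqueI)

definition reversible_filter :: "nat filter \<Rightarrow> bool" where
  "reversible_filter F \<longleftrightarrow> reversible_space (xi_space F)"

end

theory Submission
  imports Defs
begin

text \<open>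
  A permutation \<open>f\<close> of \<open>\<omega>\<close> acts on \<open>\<omega>\<^sup>*\<close>, and it witnesses that \<open>F\<close> is non-reversible as soon as it
  maps \<open>K\<^sub>F\<close> onto a proper subset of \<open>K\<^sub>F\<close>. So \<open>X\<close> has to be placed in \<open>\<omega>\<^sup>*\<close> in such a way that a
  homeomorphism of \<open>X\<close> with a proper subspace becomes the action of a permutation.

  Let \<open>h\<close> be a homeomorphism of \<open>X\<close> onto the proper clopen set \<open>Y\<close>, and put \<open>Z = X - Y\<close>. The
  clopen sets \<open>h\<^sup>k(Z)\<close>, \<open>k \<in> \<nat>\<close>, are disjoint copies of \<open>Z\<close>; let \<open>R\<close> be the complement of the closure
  of their union, which is again clopen. Cut \<open>\<omega>\<close> into copies \<open>A\<^sub>k\<close>, \<open>k \<in> \<int>\<close>, and \<open>B\<close> of itself. The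
  given embedding of \<open>X\<close> in \<open>\<omega>\<^sup>*\<close>, restricted to \<open>Z\<close> and to \<open>R\<close>, places one and the same copy of \<open>Z\<close>
  in every \<open>A\<^sub>k\<^sup>*\<close> with \<open>k \<ge> 0\<close> and a copy of \<open>R\<close> in \<open>B\<^sup>*\<close>, while the \<open>A\<^sub>k\<^sup>*\<close> with \<open>k < 0\<close> stay empty.
  Let \<open>F\<close> be the filter of all sets that belong to all the ultrafilters placed so far. The permutation
  that shifts \<open>A\<^sub>k\<close> to \<open>A\<^sub>k\<^sub>+\<^sub>1\<close> and fixes \<open>B\<close> vacates \<open>A\<^sub>0\<close>, so \<open>F\<close> is non-reversible
  (\<open>not_reversible_sum_filter\<close>).

  It remains to see that \<open>K\<^sub>F\<close>, the closure of the union of the copies, is a weak P-set and is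
  homeomorphic to \<open>X\<close>. The first is a diagonal argument over the countably many copies of \<open>\<omega>\<close>
  (\<open>weak_P_set_sum_filter\<close>). For the second (\<open>homeomorphic_space_K_sum_filter\<close>), the clopen pieces
  have dense union in \<open>X\<close>, and because \<open>X\<close> is extremally disconnected, a point of \<open>X\<close> is determined
  by an ultrafilter of clopen subsets of that union, just as a point of \<open>K\<^sub>F\<close> is.
\<close>

section \<open>Ultrafilters and the topology of the space of free ultrafilters\<close>

lemma ultrafilter_not_eventually_iff:
  assumes "ultrafilter p"
  shows "eventually (\<lambda>x. \<not> P x) p \<longleftrightarrow> \<not> eventually P p"
proof -
  have "eventually P p \<or> eventually (\<lambda>x. \<not> P x) p"
    using assms[unfolded ultrafilter_def, THEN conjunct2, THEN spec, of "{x. P x}"] by simp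
  moreover have False if "eventually P p" "eventually (\<lambda>x. \<not> P x) p"
  proof -
    have "eventually (\<lambda>x. False) p"
      using eventually_conj[OF that] by simp
    then show False
      using assms by (simp add: ultrafilter_def trivial_limit_def)
  qed
  ultimately show ?thesis by blast
qed

lemma ultrafilter_filtermap:
  assumes "ultrafilter p"
  shows "ultrafilter (filtermap f p)"
  unfolding ultrafilter_def eventually_filtermap
  using assms ultrafilter_not_eventually_iff[OF assms, of "\<lambda>x. f x \<in> A" for A]
  by (simp add: ultrafilter_def filtermap_bot_iff)

lemma ultrafilter_le_imp_eq:
  assumes "ultrafilter p" "ultrafilter q" "p \<le> q"
  shows "p = q"
proof -
  have "eventually P p \<longleftrightarrow> eventually P q" for P
    using filter_leD[OF assms(3), of P] filter_leD[OF assms(3), of "\<lambda>x. \<not> P x"]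
      ultrafilter_not_eventually_iff[OF assms(1), of P]
      ultrafilter_not_eventually_iff[OF assms(2), of P]
    by blast
  then show ?thesis by (simp add: filter_eq_iff)
qed

lemma ultrafilter_principal_singleton: "ultrafilter (principal {n})"
  by (simp add: ultrafilter_def eventually_principal principal_eq_bot_iff)

lemma ultrafilter_eventually_finite_UN:
  assumes "ultrafilter p" "finite I" "eventually (\<lambda>n. \<exists>i\<in>I. P i n) p"
  shows "\<exists>i\<in>I. eventually (P i) p"
proof (rule ccontr)
  assume "\<not> ?thesis"
  then have "\<forall>i\<in>I. eventually (\<lambda>n. \<not> P i n) p"
    using ultrafilter_not_eventually_iff[OF assms(1)] by blast
  then have "eventually (\<lambda>n. \<forall>i\<in>I. \<not> P i n) p"
    by (rule eventually_ball_finite[OF assms(2)])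
  then show False
    using ultrafilter_not_eventually_iff[OF assms(1), of "\<lambda>n. \<exists>i\<in>I. P i n"] assms(3) by simp
qed

lemma topspace_omega_star: "topspace omega_star = {p. ultrafilter p \<and> p \<le> cofinite}"
proof -
  have "p \<le> cofinite \<longleftrightarrow> p \<notin> range (\<lambda>n. principal {n})" if p: "ultrafilter p" for p :: "nat filter"
  proof
    assume le: "p \<le> cofinite"
    show "p \<notin> range (\<lambda>n. principal {n})"
    proof
      assume "p \<in> range (\<lambda>n. principal {n})"
      then obtain n where n: "p = principal {n}" by blast
      have "eventually (\<lambda>x. x \<noteq> n) cofinite"
        by (simp add: eventually_cofinite)
      then have "eventually (\<lambda>x. x \<noteq> n) p"
        using le by (rule filter_leD[rotated])
      then show False by (simp add: n eventually_principal)
    qed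
  next
    assume np: "p \<notin> range (\<lambda>n. principal {n})"
    have *: "eventually (\<lambda>x. x \<noteq> n) p" for n
    proof (rule ccontr)
      assume "\<not> ?thesis"
      then have "eventually (\<lambda>x. x \<in> {n}) p"
        using ultrafilter_not_eventually_iff[OF p, of "\<lambda>x. x = n"] by simp
      then have "p \<le> principal {n}" by (simp add: le_principal)
      then have "p = principal {n}"
        using ultrafilter_le_imp_eq[OF p ultrafilter_principal_singleton] by blast
      then show False using np by blast
    qed
    show "p \<le> cofinite"
    proof (rule filter_leI)
      fix P :: "nat \<Rightarrow> bool"
      assume "eventually P cofinite"
      then have fin: "finite {x. \<not> P x}" by (simp add: eventually_cofinite)
      have "eventually (\<lambda>x. \<forall>n\<in>{x. \<not> P x}. x \<noteq> n) p"
        by (rule eventually_ball_finite[OF fin]) (use * in blast)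
      then show "eventually P p" by (rule eventually_mono) blast
    qed
  qed
  then show ?thesis
    by (auto simp: omega_star_def topspace_beta_omega)
qed

lemma openin_omega_star_basic:
  "openin omega_star {p \<in> topspace omega_star. eventually P p}"
proof -
  have "openin beta_omega {p. ultrafilter p \<and> eventually (\<lambda>n. n \<in> {n. P n}) p}"
    unfolding beta_omega_def by (rule topology_generated_by_Basis) blast
  then have "openin omega_star
      ((topspace beta_omega - range (\<lambda>n. principal {n}))
        \<inter> {p. ultrafilter p \<and> eventually (\<lambda>n. n \<in> {n. P n}) p})"
    unfolding omega_star_def openin_subtopology by blast
  also have "(topspace beta_omega - range (\<lambda>n. principal {n}))
        \<inter> {p. ultrafilter p \<and> eventually (\<lambda>n. n \<in> {n. P n}) p}
      = {p \<in> topspace omega_star. eventually P p}"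
    by (auto simp: omega_star_def topspace_beta_omega)
  finally show ?thesis .
qed

lemma openin_omega_starD:
  assumes "openin omega_star V" "p \<in> V"
  obtains P where "eventually P p" "{q \<in> topspace omega_star. eventually P q} \<subseteq> V"
proof -
  obtain T where T: "openin beta_omega T" "V = T \<inter> (topspace beta_omega - range (\<lambda>n. principal {n}))"
    using assms(1) unfolding omega_star_def openin_subtopology by blast
  have "\<exists>P. eventually P p \<and> (\<forall>q\<in>topspace beta_omega. eventually P q \<longrightarrow> q \<in> T)"
    if "generate_topology_on (range (\<lambda>A. {p. ultrafilter p \<and> eventually (\<lambda>n. n \<in> A) p})) T" "p \<in> T"
    for T
    using that
  proof (induction rule: generate_topology_on.induct)
    case (Int a b)
    then obtain P Q where "eventually P p" "\<forall>q\<in>topspace beta_omega. eventually P q \<longrightarrow> q \<in> a"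
      "eventually Q p" "\<forall>q\<in>topspace beta_omega. eventually Q q \<longrightarrow> q \<in> b"
      by blast
    then show ?case
      by (intro exI[of _ "\<lambda>x. P x \<and> Q x"]) (auto simp: eventually_conj_iff)
  next
    case (UN K)
    from UN.prems obtain k where k: "k \<in> K" "p \<in> k" by blast
    then obtain P where "eventually P p" "\<forall>q\<in>topspace beta_omega. eventually P q \<longrightarrow> q \<in> k"
      using UN.IH by blast
    then show ?case using k(1) by blast
  next
    case (Basis s)
    then show ?case by (auto simp: topspace_beta_omega)
  qed simp
  then obtain P where "eventually P p" "\<forall>q\<in>topspace beta_omega. eventually P q \<longrightarrow> q \<in> T"
    using T assms(2) unfolding beta_omega_def openin_topology_generated_by_iff by blast
  then show thesis
    using T that[of P] by (auto simp: omega_star_def)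
qed

lemma continuous_map_into_omega_star:
  assumes "\<And>x. x \<in> topspace X \<Longrightarrow> f x \<in> topspace omega_star"
    and "\<And>P. openin X {x \<in> topspace X. eventually P (f x)}"
  shows "continuous_map X omega_star f"
  unfolding continuous_map_def
proof (intro conjI allI impI)
  show "f \<in> topspace X \<rightarrow> topspace omega_star" using assms(1) by (rule Pi_I)
  fix V assume V: "openin omega_star V"
  show "openin X {x \<in> topspace X. f x \<in> V}"
  proof (subst openin_subopen, intro ballI)
    fix x assume x: "x \<in> {x \<in> topspace X. f x \<in> V}"
    then obtain P where P: "eventually P (f x)" "{q \<in> topspace omega_star. eventually P q} \<subseteq> V"
      using openin_omega_starD[OF V, of "f x"] by blast
    show "\<exists>T. openin X T \<and> x \<in> T \<and> T \<subseteq> {x \<in> topspace X. f x \<in> V}"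
      using assms P x by (intro exI[of _ "{x \<in> topspace X. eventually P (f x)}"]) blast
  qed
qed

lemma Hausdorff_space_omega_star: "Hausdorff_space omega_star"
  unfolding Hausdorff_space_def
proof (intro allI impI)
  fix p q
  assume pq: "p \<in> topspace omega_star \<and> q \<in> topspace omega_star \<and> p \<noteq> q"
  then have u: "ultrafilter p" "ultrafilter q" by (auto simp: topspace_omega_star)
  then have "\<not> q \<le> p" using ultrafilter_le_imp_eq pq by metis
  then obtain P where P: "eventually P p" "\<not> eventually P q"
    by (auto simp: le_filter_def)
  let ?U = "\<lambda>P. {r \<in> topspace omega_star. eventually P r}"
  have "?U P \<inter> ?U (\<lambda>n. \<not> P n) = {}"
    using ultrafilter_not_eventually_iff by (auto simp: topspace_omega_star)
  moreover have "p \<in> ?U P" "q \<in> ?U (\<lambda>n. \<not> P n)"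
    using P pq ultrafilter_not_eventually_iff[OF u(2)] by auto
  ultimately show "\<exists>U V. openin omega_star U \<and> openin omega_star V \<and> p \<in> U \<and> q \<in> V \<and> disjnt U V"
    using openin_omega_star_basic unfolding disjnt_def by blast
qed

text \<open>
  Finitely many basic neighbourhoods that avoid \<open>T\<close> cover \<open>S\<close>, and a finite union of basic
  sets is basic.
\<close>

lemma separate_compactin_closedin_omega_star:
  assumes S: "compactin omega_star S" and T: "closedin omega_star T" and "S \<inter> T = {}"
  obtains P where "\<And>p. p \<in> S \<Longrightarrow> eventually P p" "\<And>p. p \<in> T \<Longrightarrow> \<not> eventually P p"
proof -
  let ?B = "\<lambda>P. {q \<in> topspace omega_star. eventually P q}"
  let ?\<U> = "{U. \<exists>P. U = ?B P \<and> U \<inter> T = {}}"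
  have "S \<subseteq> \<Union>?\<U>"
  proof
    fix p assume p: "p \<in> S"
    have "openin omega_star (topspace omega_star - T)" using T by blast
    moreover have "p \<in> topspace omega_star - T"
      using p assms compactin_subset_topspace by blast
    ultimately obtain P where "eventually P p" "?B P \<subseteq> topspace omega_star - T"
      by (rule openin_omega_starD)
    then show "p \<in> \<Union>?\<U>"
      using \<open>p \<in> topspace omega_star - T\<close> by blast
  qed
  moreover have "\<And>U. U \<in> ?\<U> \<Longrightarrow> openin omega_star U"
    using openin_omega_star_basic by auto
  ultimately obtain \<F> where F: "finite \<F>" "\<F> \<subseteq> ?\<U>" "S \<subseteq> \<Union>\<F>"
    using compactinD[OF S, of ?\<U>] by blast
  then have "\<forall>U\<in>\<F>. \<exists>P. U = ?B P \<and> U \<inter> T = {}" by blast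
  then obtain P where P: "\<And>U. U \<in> \<F> \<Longrightarrow> U = ?B (P U)" "\<And>U. U \<in> \<F> \<Longrightarrow> U \<inter> T = {}"
    by metis
  have T_sub: "T \<subseteq> topspace omega_star" using T by (simp add: closedin_def)
  show thesis
  proof (rule that[of "\<lambda>n. \<exists>U\<in>\<F>. P U n"])
    fix p assume "p \<in> S"
    then obtain U where "U \<in> \<F>" "p \<in> U" using F by blast
    then have "eventually (P U) p" using P(1) by blast
    then show "eventually (\<lambda>n. \<exists>U\<in>\<F>. P U n) p"
      using \<open>U \<in> \<F>\<close> by (auto elim: eventually_mono)
  next
    fix p assume p: "p \<in> T"
    then have up: "ultrafilter p" using T_sub by (auto simp: topspace_omega_star)
    show "\<not> eventually (\<lambda>n. \<exists>U\<in>\<F>. P U n) p"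
    proof
      assume "eventually (\<lambda>n. \<exists>U\<in>\<F>. P U n) p"
      then obtain U where "U \<in> \<F>" "eventually (P U) p"
        using ultrafilter_eventually_finite_UN[OF up F(1)] by metis
      then have "p \<in> U" using P(1)[of U] p T_sub by blast
      then show False using P(2)[OF \<open>U \<in> \<F>\<close>] p by blast
    qed
  qed
qed

lemma K_filter_eq:
  assumes "F \<le> cofinite"
  shows "K_filter F = {p \<in> topspace omega_star. p \<le> F}"
  using assms by (auto simp: K_filter_def topspace_beta_omega topspace_omega_star)


section \<open>Weak P-sets\<close>

text \<open>
  For compact \<open>S\<close> this is the property of being a weak P-set, in a form that mentions only
  subsets of \<open>\<omega>\<close> and so can be carried from one copy of \<open>\<omega>\<close> to another.
\<close>

definition countably_separated :: "nat filter set \<Rightarrow> bool" where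
  "countably_separated S \<longleftrightarrow>
     (\<forall>D. countable D \<longrightarrow> D \<subseteq> topspace omega_star - S \<longrightarrow>
        (\<exists>P. (\<forall>p\<in>S. eventually P p) \<and> (\<forall>p\<in>D. \<not> eventually P p)))"

lemma countably_separated_weak_P_set:
  assumes "compactin omega_star S" "weak_P_set omega_star S"
  shows "countably_separated S"
  unfolding countably_separated_def
proof (intro allI impI)
  fix D assume D: "countable D" "D \<subseteq> topspace omega_star - S"
  then have "S \<inter> omega_star closure_of D = {}"
    using assms(2) unfolding weak_P_set_def by blast
  then obtain P where "\<And>p. p \<in> S \<Longrightarrow> eventually P p"
      "\<And>p. p \<in> omega_star closure_of D \<Longrightarrow> \<not> eventually P p"
    using separate_compactin_closedin_omega_star[OF assms(1) closedin_closure_of] by blast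
  moreover have "D \<subseteq> omega_star closure_of D"
    using D by (intro closure_of_subset) blast
  ultimately show "\<exists>P. (\<forall>p\<in>S. eventually P p) \<and> (\<forall>p\<in>D. \<not> eventually P p)"
    by blast
qed

text \<open>
  Some set \<open>Q\<close> of naturals separates \<open>S\<close> from \<open>T\<close>. The members of \<open>D\<close> that do not contain \<open>Q\<close> are
  excluded by \<open>Q\<close> itself, and the others lie outside of \<open>S \<union> T\<close>.
\<close>

lemma countably_separated_part:
  assumes "countably_separated (S \<union> T)" "compactin omega_star S" "compactin omega_star T"
    and "S \<inter> T = {}"
  shows "countably_separated S"
  unfolding countably_separated_def
proof (intro allI impI)
  fix D assume D: "countable D" "D \<subseteq> topspace omega_star - S"
  have "closedin omega_star T"
    using assms(3) Hausdorff_space_omega_star by (simp add: compactin_imp_closedin)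
  then obtain Q where Q: "\<And>p. p \<in> S \<Longrightarrow> eventually Q p" "\<And>p. p \<in> T \<Longrightarrow> \<not> eventually Q p"
    using separate_compactin_closedin_omega_star assms by metis
  let ?D = "{p \<in> D. eventually Q p}"
  have "countable ?D" "?D \<subseteq> topspace omega_star - (S \<union> T)"
    using D Q by auto
  then obtain P where "\<forall>p\<in>S \<union> T. eventually P p" "\<forall>p\<in>?D. \<not> eventually P p"
    using assms(1) unfolding countably_separated_def by meson
  then show "\<exists>P. (\<forall>p\<in>S. eventually P p) \<and> (\<forall>p\<in>D. \<not> eventually P p)"
    using Q by (intro exI[of _ "\<lambda>n. P n \<and> Q n"]) (auto simp: eventually_conj_iff)
qed

lemma weak_P_set_K_filterI:
  assumes "F \<le> cofinite"
    and "\<And>D. countable D \<Longrightarrow> D \<subseteq> topspace omega_star - K_filter F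
           \<Longrightarrow> \<exists>P. eventually P F \<and> (\<forall>p\<in>D. \<not> eventually P p)"
  shows "weak_P_set omega_star (K_filter F)"
  unfolding weak_P_set_def
proof (intro conjI allI impI)
  show "closedin omega_star (K_filter F)"
    unfolding closedin_def
  proof (intro conjI)
    show "K_filter F \<subseteq> topspace omega_star"
      using K_filter_eq[OF assms(1)] by blast
    have "topspace omega_star - K_filter F
        = (\<Union>P\<in>{P. eventually P F}. {p \<in> topspace omega_star. eventually (\<lambda>n. \<not> P n) p})"
      using K_filter_eq[OF assms(1)] ultrafilter_not_eventually_iff
      by (auto simp: le_filter_def topspace_omega_star)
    then show "openin omega_star (topspace omega_star - K_filter F)"
      using openin_omega_star_basic by auto
  qed
  fix D assume "countable D \<and> D \<subseteq> topspace omega_star - K_filter F"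
  then obtain P where P: "eventually P F" "\<forall>p\<in>D. \<not> eventually P p"
    using assms(2) by blast
  let ?U = "{p \<in> topspace omega_star. eventually P p}"
  have "?U \<inter> D = {}" using P by blast
  then have "?U \<inter> omega_star closure_of D = {}"
    using openin_Int_closure_of_eq_empty[OF openin_omega_star_basic] by blast
  moreover have "K_filter F \<subseteq> ?U"
    using P(1) K_filter_eq[OF assms(1)] by (auto intro: filter_leD)
  ultimately show "omega_star closure_of D \<inter> K_filter F = {}" by blast
qed


section \<open>Sums of filters over countably many copies of the natural numbers\<close>

text \<open>
  The bijection \<open>enc\<close> cuts \<open>\<omega>\<close> into the copies \<open>range (\<lambda>n. enc (i, n))\<close> of itself; a set is in
  the sum iff its trace on the \<open>i\<close>-th copy is in \<open>G i\<close> for every \<open>i\<close>.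
\<close>

definition sum_filter :: "('i \<times> nat \<Rightarrow> nat) \<Rightarrow> ('i \<Rightarrow> nat filter) \<Rightarrow> nat filter" where
  "sum_filter enc G = (SUP i. filtermap (\<lambda>n. enc (i, n)) (G i))"

lemma eventually_sum_filter:
  "eventually P (sum_filter enc G) \<longleftrightarrow> (\<forall>i. eventually (\<lambda>n. P (enc (i, n))) (G i))"
  unfolding sum_filter_def by (simp add: eventually_Sup eventually_filtermap)

lemma sum_filter_le_cofinite:
  assumes "inj enc" "\<And>i. G i \<le> cofinite"
  shows "sum_filter enc G \<le> cofinite"
proof (rule filter_leI)
  fix P :: "nat \<Rightarrow> bool"
  assume P: "eventually P cofinite"
  show "eventually P (sum_filter enc G)"
    unfolding eventually_sum_filter
  proof
    fix i
    have inj: "inj (\<lambda>n. enc (i, n))"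
      using assms(1) by (auto simp: inj_on_def)
    have "finite ((\<lambda>n. enc (i, n)) -` {n. \<not> P n})"
      using P by (intro finite_vimageI inj) (simp add: eventually_cofinite)
    then have "eventually (\<lambda>n. P (enc (i, n))) cofinite"
      by (simp add: eventually_cofinite vimage_def)
    then show "eventually (\<lambda>n. P (enc (i, n))) (G i)"
      using assms(2) by (rule filter_leD[rotated])
  qed
qed

text \<open>
  Let \<open>D\<close> be a countable set of free ultrafilters, none of which contains the sum. The members of
  \<open>D\<close> that concentrate on the \<open>i\<close>-th copy are excluded by a single set \<open>A i\<close> that belongs to all
  members of \<open>S i\<close>. Each remaining member \<open>p\<close> is excluded by some set \<open>T p\<close> of the sum. Number the
  members of \<open>D\<close> and the copies, and inside a copy with number \<open>k\<close> intersect \<open>A i\<close> with the traces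
  of the finitely many sets \<open>T p\<close> whose \<open>p\<close> has number at most \<open>k\<close>. The resulting set is still in
  the sum, and it is contained in \<open>T p\<close> except on finitely many copies, none of which belongs to \<open>p\<close>.
\<close>

lemma weak_P_set_sum_filter:
  fixes enc :: "'i \<times> nat \<Rightarrow> nat"
  assumes enc: "bij enc"
    and S: "\<And>i. S i \<subseteq> topspace omega_star" "\<And>i. countably_separated (S i)"
  shows "weak_P_set omega_star (K_filter (sum_filter enc (\<lambda>i. Sup (S i))))"
proof -
  define F where "F = sum_filter enc (\<lambda>i. Sup (S i))"
  have inj: "enc (i, n) = enc (j, m) \<longleftrightarrow> i = j \<and> n = m" for i j n m
    using bij_is_inj[OF enc] by (auto simp: inj_on_def)
  have F_le: "F \<le> cofinite"
    unfolding F_def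
    by (intro sum_filter_le_cofinite bij_is_inj[OF enc] Sup_least)
      (use S(1) in \<open>auto simp: topspace_omega_star\<close>)
  show ?thesis
    unfolding F_def[symmetric]
  proof (rule weak_P_set_K_filterI[OF F_le])
    fix D assume D: "countable D" "D \<subseteq> topspace omega_star - K_filter F"
    let ?m = "\<lambda>i. filtermap (\<lambda>n. enc (i, n))"
    have "\<forall>i. \<exists>P. (\<forall>p\<in>S i. eventually P p) \<and>
          (\<forall>q\<in>{q \<in> topspace omega_star. ?m i q \<in> D}. \<not> eventually P q)"
    proof
      fix i
      let ?D = "{q \<in> topspace omega_star. ?m i q \<in> D}"
      have "inj (?m i)"
        by (intro injI) (simp add: filtermap_eq_strong inj inj_on_def)
      then have "countable ?D"
        using countable_image_inj_on[of "?m i" ?D] D(1)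
        by (metis (no_types, lifting) countable_subset image_subsetI inj_on_subset mem_Collect_eq subset_UNIV)
      moreover have "?D \<subseteq> topspace omega_star - S i"
      proof -
        have False if "q \<in> ?D" "q \<in> S i" for q
        proof -
          have "?m i q \<le> ?m i (Sup (S i))"
            using that by (intro filtermap_mono Sup_upper)
          also have "\<dots> \<le> F"
            unfolding F_def sum_filter_def by (intro SUP_upper) simp
          finally have "?m i q \<in> K_filter F"
            using that D by (auto simp: K_filter_eq[OF F_le])
          then show False using that D by blast
        qed
        then show ?thesis by blast
      qed
      ultimately show "\<exists>P. (\<forall>p\<in>S i. eventually P p) \<and> (\<forall>q\<in>?D. \<not> eventually P q)"
        using S(2)[of i] unfolding countably_separated_def by meson
    qed
    from choice[OF this] obtain A where A: "\<And>i p. p \<in> S i \<Longrightarrow> eventually (A i) p"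
      "\<And>i q. \<lbrakk>q \<in> topspace omega_star; ?m i q \<in> D\<rbrakk> \<Longrightarrow> \<not> eventually (A i) q"
      by blast
    have "\<forall>p\<in>D. \<exists>T. eventually T F \<and> \<not> eventually T p"
      using D by (auto simp: K_filter_eq[OF F_le] le_filter_def)
    then obtain T where T: "\<And>p. p \<in> D \<Longrightarrow> eventually (T p) F" "\<And>p. p \<in> D \<Longrightarrow> \<not> eventually (T p) p"
      by metis
    \<comment> \<open>Enumerations of the copies and of \<open>D\<close>.\<close>
    define r :: "'i \<Rightarrow> nat" where "r i = enc (i, 0)" for i
    have inj_r: "inj r" by (simp add: r_def inj_on_def inj)
    define s where "s = to_nat_on D"
    have inj_s: "inj_on s D" unfolding s_def using D(1) by (rule inj_on_to_nat_on)
    define E where "E k = {p \<in> D. s p \<le> k}" for k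
    have fin_E: "finite (E k)" for k
    proof -
      have "inj_on s (E k)" "s ` E k \<subseteq> {..k}"
        using inj_s by (auto simp: E_def inj_on_def)
      then show ?thesis by (meson finite_atMost finite_imageD finite_subset)
    qed
    define Q where "Q x \<longleftrightarrow> (\<exists>i n. x = enc (i, n) \<and> A i n \<and> (\<forall>p\<in>E (r i). T p x))" for x
    have Q_enc: "Q (enc (i, n)) \<longleftrightarrow> A i n \<and> (\<forall>p\<in>E (r i). T p (enc (i, n)))" for i n
      by (auto simp: Q_def inj)
    have "eventually Q F"
      unfolding F_def eventually_sum_filter Q_enc
    proof
      fix i
      have "eventually (\<lambda>n. T p (enc (i, n))) (Sup (S i))" if "p \<in> E (r i)" for p
        using T(1)[of p] that unfolding F_def eventually_sum_filter E_def by blast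
      then have "eventually (\<lambda>n. \<forall>p\<in>E (r i). T p (enc (i, n))) (Sup (S i))"
        by (intro eventually_ball_finite fin_E) blast
      moreover have "eventually (A i) (Sup (S i))"
        using A(1) by (simp add: eventually_Sup)
      ultimately show "eventually (\<lambda>n. A i n \<and> (\<forall>p\<in>E (r i). T p (enc (i, n)))) (Sup (S i))"
        by (simp add: eventually_conj_iff)
    qed
    moreover have "\<not> eventually Q p" if p: "p \<in> D" for p
    proof
      assume Qp: "eventually Q p"
      have up: "ultrafilter p"
        using p D by (auto simp: topspace_omega_star)
      show False
      proof (cases "\<exists>i. eventually (\<lambda>x. \<exists>n. x = enc (i, n)) p")
        case True
        then obtain i where i: "eventually (\<lambda>x. \<exists>n. x = enc (i, n)) p" by blast
        \<comment> \<open>Here \<open>p\<close> is the image of a free ultrafilter \<open>q\<close> under the inclusion of the \<open>i\<close>-th copy.\<close>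
        let ?d = "\<lambda>x. snd (inv enc x)"
        have d: "?d (enc (i, n)) = n" for n
          using bij_is_inj[OF enc] by simp
        define q where "q = filtermap ?d p"
        have "eventually P (?m i q) \<longleftrightarrow> eventually P p" for P
        proof -
          have "eventually (\<lambda>x. P (enc (i, ?d x)) \<longleftrightarrow> P x) p"
            using i by (rule eventually_mono) (auto simp: d)
          then show ?thesis
            by (simp add: q_def eventually_filtermap eventually_subst)
        qed
        then have mq: "?m i q = p" by (simp add: filter_eq_iff)
        have "q \<notin> range (\<lambda>n. principal {n})"
        proof
          assume "q \<in> range (\<lambda>n. principal {n})"
          then obtain n where "q = principal {n}" by blast
          then have "p = principal {enc (i, n)}"
            using mq by (simp add: filtermap_principal)
          then show False
            using p D by (auto simp: omega_star_def)
        qed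
        then have "q \<in> topspace omega_star"
          using ultrafilter_filtermap[OF up, of ?d]
          by (simp add: q_def omega_star_def topspace_beta_omega)
        then have "\<not> eventually (A i) q"
          using A(2)[of q i] mq p by simp
        moreover have "eventually (A i) q"
          unfolding q_def eventually_filtermap
          using eventually_conj[OF Qp i] by (rule eventually_mono) (auto simp: d Q_enc)
        ultimately show False by blast
      next
        case False
        \<comment> \<open>The copies on which \<open>Q\<close> was not intersected with \<open>T p\<close>.\<close>
        let ?I = "{i. r i < s p}"
        have "finite ?I"
          using finite_vimageI[OF finite_lessThan inj_r, of "s p"] by (simp add: vimage_def)
        have "eventually (\<lambda>x. \<not> T p x) p"
          using T(2)[OF p] ultrafilter_not_eventually_iff[OF up] by blast
        with Qp have "eventually (\<lambda>x. Q x \<and> \<not> T p x) p" by (rule eventually_conj)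
        then have "eventually (\<lambda>x. \<exists>i\<in>?I. \<exists>n. x = enc (i, n)) p"
        proof (rule eventually_mono)
          fix x assume x: "Q x \<and> \<not> T p x"
          then obtain i n where i: "x = enc (i, n)" "\<forall>p\<in>E (r i). T p x"
            unfolding Q_def by blast
          then have "p \<notin> E (r i)" using x by blast
          then have "r i < s p" using p by (simp add: E_def not_le)
          then show "\<exists>i\<in>?I. \<exists>n. x = enc (i, n)" using i(1) by blast
        qed
        then show False
          using ultrafilter_eventually_finite_UN[OF up \<open>finite ?I\<close>, of "\<lambda>i x. \<exists>n. x = enc (i, n)"]
            False by blast
      qed
    qed
    ultimately show "\<exists>P. eventually P F \<and> (\<forall>p\<in>D. \<not> eventually P p)" by blast
  qed
qed

text \<open>
  A permutation of the copies induces a bijection of \<open>\<xi>(F)\<close>, where \<open>F\<close> is the sum, that fixes the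
  added point. It is continuous because \<open>G i \<le> G (\<sigma> i)\<close>; it is not open because the \<open>j\<close>-th copy is
  negligible while its image is not.
\<close>

lemma not_reversible_sum_filter:
  fixes enc :: "'i \<times> nat \<Rightarrow> nat"
  assumes enc: "bij enc" and \<sigma>: "bij \<sigma>"
    and le: "\<And>i. G i \<le> G (\<sigma> i)"
    and j: "G j = bot" "G (\<sigma> j) \<noteq> bot"
  shows "\<not> reversible_filter (sum_filter enc G)"
proof
  let ?F = "sum_filter enc G"
  assume rev: "reversible_filter ?F"
  define f where "f = enc \<circ> map_prod \<sigma> id \<circ> inv enc"
  have bij_f: "bij f"
    unfolding f_def by (intro bij_comp enc bij_imp_bij_inv) (simp add: \<sigma> bij_betw_map_prod flip: UNIV_Times_UNIV)
  have f: "f (enc (i, n)) = enc (\<sigma> i, n)" for i n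
    using bij_is_inj[OF enc] by (simp add: f_def)
  have inj: "enc (i, n) = enc (j, m) \<longleftrightarrow> i = j \<and> n = m" for i j n m
    using bij_is_inj[OF enc] by (auto simp: inj_on_def)
  let ?h = "map_option f"
  have bij_h: "bij ?h"
    using bij_f by (simp add: bij_def option.inj_map inj_on_def surj_def) 
      (metis not_None_eq option.map(1) option.map(2))
  have "continuous_map (xi_space ?F) (xi_space ?F) ?h"
    unfolding continuous_map_def topspace_xi_space openin_xi_space
    using le by (auto simp: eventually_sum_filter f intro: filter_leD)
  then have "homeomorphic_map (xi_space ?F) (xi_space ?F) ?h"
    using rev bij_h unfolding reversible_filter_def reversible_space_def topspace_xi_space by blast
  then have open_h: "open_map (xi_space ?F) (xi_space ?F) ?h"
    by (simp add: homeomorphic_eq_everything_map)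
  let ?A = "{x. \<forall>n. x \<noteq> Some (enc (j, n))}"
  have "openin (xi_space ?F) ?A"
    unfolding openin_xi_space eventually_sum_filter
  proof (intro impI allI)
    fix i
    show "eventually (\<lambda>n. Some (enc (i, n)) \<in> ?A) (G i)"
      by (cases "i = j") (simp_all add: j(1) inj)
  qed
  then have "openin (xi_space ?F) (?h ` ?A)"
    using open_h by (simp add: open_map_def)
  moreover have "None \<in> ?h ` ?A" by force
  ultimately have "eventually (\<lambda>n. Some (enc (\<sigma> j, n)) \<in> ?h ` ?A) (G (\<sigma> j))"
    unfolding openin_xi_space eventually_sum_filter by blast
  moreover have "Some (enc (\<sigma> j, n)) \<notin> ?h ` ?A" for n
  proof
    assume "Some (enc (\<sigma> j, n)) \<in> ?h ` ?A"
    then obtain x where x: "Some (enc (\<sigma> j, n)) = ?h x" "x \<in> ?A" by (rule imageE)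
    then have "?h x = ?h (Some (enc (j, n)))" by (simp add: f)
    then have "x = Some (enc (j, n))"
      using bij_is_inj[OF bij_h] by (simp only: inj_eq)
    then show False using x(2) by blast
  qed
  ultimately show False
    using j(2) by (simp add: eventually_False)
qed


section \<open>Extremally disconnected spaces as sums of clopen pieces\<close>

text \<open>
  This is what makes the closures of open sets behave like a Boolean algebra of clopen sets: together
  with additivity, taking closures turns complements into complements.
\<close>

lemma extremally_disconnected_closure_of_Int:
  assumes "extremally_disconnected_space X" "openin X U" "openin X V"
  shows "X closure_of (U \<inter> V) = X closure_of U \<inter> X closure_of V"
proof
  show "X closure_of (U \<inter> V) \<subseteq> X closure_of U \<inter> X closure_of V"
    by (simp add: closure_of_mono)
  have "openin X (X closure_of U)"
    using assms unfolding extremally_disconnected_space_def by blast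
  then have "X closure_of U \<inter> X closure_of V \<subseteq> X closure_of (X closure_of U \<inter> V)"
    by (rule openin_Int_closure_of_subset)
  also have "X closure_of U \<inter> V \<subseteq> X closure_of (U \<inter> V)"
    using openin_Int_closure_of_subset[OF assms(3), of U] by (simp add: Int_commute)
  then have "X closure_of (X closure_of U \<inter> V) \<subseteq> X closure_of (U \<inter> V)"
    by (rule closure_of_minimal) simp
  finally show "X closure_of U \<inter> X closure_of V \<subseteq> X closure_of (U \<inter> V)" .
qed

text \<open>
  The pieces \<open>g i ` V i\<close> are disjoint open sets with dense union, and a point \<open>g i z\<close> of the \<open>i\<close>-th
  piece corresponds to the copy of the ultrafilter \<open>e z\<close> that lives on the \<open>i\<close>-th copy of \<open>\<omega>\<close>. A
  subset of \<open>\<omega>\<close> thus determines an open subset \<open>W\<close> of the union of the pieces, namely the points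
  whose ultrafilter contains it, and the point \<open>x\<close> of \<open>X\<close> is sent to the ultrafilter of
  those sets whose \<open>W\<close> has \<open>x\<close> in its closure. Extremal disconnectedness makes the closure commute
  with finite intersections on open sets, so this is an ultrafilter. Every clopen subset of \<open>X\<close> is
  the closure of some \<open>W\<close>, which gives injectivity, and surjectivity follows by compactness.
\<close>

lemma homeomorphic_space_K_sum_filter:
  fixes X :: "'a topology" and enc :: "'i \<times> nat \<Rightarrow> nat"
  assumes X: "Hausdorff_space X" "compact_space X" "extremally_disconnected_space X"
    and e: "continuous_map X omega_star e" "inj_on e (topspace X)"
    and enc: "bij enc"
    and V: "\<And>i. openin X (V i)" "\<And>i. closedin X (V i)"
    and g: "\<And>i. continuous_map X X (g i)" "\<And>i. open_map X X (g i)" "\<And>i. inj_on (g i) (topspace X)"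
    and disj: "\<And>i j. i \<noteq> j \<Longrightarrow> g i ` V i \<inter> g j ` V j = {}"
    and dense: "X closure_of (\<Union>i. g i ` V i) = topspace X"
  shows "subtopology omega_star (K_filter (sum_filter enc (\<lambda>i. Sup (e ` V i)))) homeomorphic_space X"
proof -
  define F where "F = sum_filter enc (\<lambda>i. Sup (e ` V i))"
  have inj: "enc (i, n) = enc (j, m) \<longleftrightarrow> i = j \<and> n = m" for i j n m
    using bij_is_inj[OF enc] by (auto simp: inj_on_def)
  have V_sub: "V i \<subseteq> topspace X" for i
    using V(1) openin_subset by blast
  have e_top: "e x \<in> topspace omega_star" if "x \<in> topspace X" for x
    using continuous_map_funspace[OF e(1)] that by blast
  then have e_u: "ultrafilter (e x)" if "x \<in> topspace X" for x
    using that by (auto simp: topspace_omega_star)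
  have F_le: "F \<le> cofinite"
    unfolding F_def
    by (intro sum_filter_le_cofinite bij_is_inj[OF enc] Sup_least)
      (use e_top V_sub in \<open>auto simp: topspace_omega_star\<close>)
  define U where "U = (\<Union>i. g i ` V i)"
  have open_g: "openin X (g i ` O')" if "openin X O'" for i O'
    using g(2)[of i] that by (simp add: open_map_def)
  define W where "W P = (\<Union>i. g i ` {z \<in> V i. eventually (\<lambda>n. P (enc (i, n))) (e z)})" for P
  have W_iff: "g i z \<in> W P \<longleftrightarrow> eventually (\<lambda>n. P (enc (i, n))) (e z)" if "z \<in> V i" for i z P
  proof
    assume "g i z \<in> W P"
    then obtain j y where y: "y \<in> V j" "g i z = g j y" "eventually (\<lambda>n. P (enc (j, n))) (e y)"
      by (auto simp: W_def)
    then have "j = i" using disj[of i j] that by blast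
    moreover from this have "y = z"
      using y that g(3)[of i] V_sub[of i] by (metis inj_onD subsetD)
    ultimately show "eventually (\<lambda>n. P (enc (i, n))) (e z)" using y by simp
  qed (use that in \<open>auto simp: W_def\<close>)
  have W_sub: "W P \<subseteq> U" for P by (auto simp: W_def U_def)
  have open_W: "openin X (W P)" for P
    unfolding W_def
  proof (intro openin_Union ballI, clarify)
    fix i
    have "openin X {z \<in> topspace X. e z \<in> {p \<in> topspace omega_star. eventually (\<lambda>n. P (enc (i, n))) p}}"
      using e(1) openin_omega_star_basic by (rule openin_continuous_map_preimage)
    then have "openin X (V i \<inter> {z \<in> topspace X. e z \<in> {p \<in> topspace omega_star. eventually (\<lambda>n. P (enc (i, n))) p}})"
      using V(1) by (intro openin_Int)
    also have "\<dots> = {z \<in> V i. eventually (\<lambda>n. P (enc (i, n))) (e z)}"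
      using V_sub e_top by blast
    finally show "openin X (g i ` {z \<in> V i. eventually (\<lambda>n. P (enc (i, n))) (e z)})"
      by (rule open_g)
  qed
  have open_U: "openin X U" unfolding U_def using open_g V(1) by auto
  have W_Int: "W (\<lambda>n. P n \<and> Q n) = W P \<inter> W Q" for P Q
  proof -
    have "x \<in> W (\<lambda>n. P n \<and> Q n) \<longleftrightarrow> x \<in> W P \<inter> W Q" if "x \<in> U" for x
      using that unfolding U_def by (auto simp: W_iff eventually_conj_iff)
    then show ?thesis using W_sub by blast
  qed
  have W_compl: "W (\<lambda>n. \<not> P n) = U - W P" for P
  proof -
    have "x \<in> W (\<lambda>n. \<not> P n) \<longleftrightarrow> x \<notin> W P" if "x \<in> U" for x
      using that V_sub unfolding U_def
      by (auto simp: W_iff ultrafilter_not_eventually_iff[OF e_u] subset_iff)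
    then show ?thesis using W_sub by blast
  qed
  have W_all: "W P = U" if "eventually P F" for P
  proof -
    have "x \<in> W P" if "x \<in> U" for x
      using that \<open>eventually P F\<close> unfolding U_def
      by (auto simp: W_iff F_def eventually_sum_filter eventually_Sup)
    then show ?thesis using W_sub by blast
  qed
  define C where "C P = X closure_of W P" for P
  have C_Int: "C (\<lambda>n. P n \<and> Q n) = C P \<inter> C Q" for P Q
    unfolding C_def W_Int by (rule extremally_disconnected_closure_of_Int[OF X(3) open_W open_W])
  have C_all: "C P = topspace X" if "eventually P F" for P
    using dense W_all[OF that] by (simp add: C_def U_def)
  have C_False: "C (\<lambda>n. False) = {}"
  proof -
    have "e z \<noteq> bot" if "z \<in> V i" for z i
      using e_u V_sub that by (auto simp: ultrafilter_def)
    then have "W (\<lambda>n. False) = {}" by (auto simp: W_def trivial_limit_def)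
    then show ?thesis by (simp add: C_def)
  qed
  have C_mono: "C P \<subseteq> C Q" if "\<And>n. P n \<Longrightarrow> Q n" for P Q
  proof -
    have "(\<lambda>n. P n \<and> Q n) = P" using that by auto
    then show ?thesis using C_Int[of P Q] by auto
  qed
  have C_Un: "C P \<union> C (\<lambda>n. \<not> P n) = topspace X" for P
  proof -
    have "W P \<union> W (\<lambda>n. \<not> P n) = U" using W_compl W_sub by blast
    then show ?thesis
      using dense closure_of_Un[of X "W P" "W (\<lambda>n. \<not> P n)"] by (simp add: C_def U_def)
  qed
  have open_C: "openin X (C P)" for P
    using X(3) open_W unfolding C_def extremally_disconnected_space_def by blast

  define \<phi> where "\<phi> x = Abs_filter (\<lambda>P. x \<in> C P)" for x
  have ev_\<phi>: "eventually P (\<phi> x) \<longleftrightarrow> x \<in> C P" if "x \<in> topspace X" for x P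
    unfolding \<phi>_def
  proof (rule eventually_Abs_filter, unfold_locales)
    show "x \<in> C (\<lambda>n. True)" using C_all that by simp
    show "x \<in> C (\<lambda>n. P n \<and> Q n)" if "x \<in> C P" "x \<in> C Q" for P Q
      using that by (simp add: C_Int)
    show "x \<in> C Q" if "\<forall>n. P n \<longrightarrow> Q n" "x \<in> C P" for P Q
      using C_mono[of P Q] that by blast
  qed
  have \<phi>_u: "ultrafilter (\<phi> x)" if "x \<in> topspace X" for x
    unfolding ultrafilter_def trivial_limit_def
    using that C_Un by (auto simp: ev_\<phi> C_False)
  have \<phi>_le: "\<phi> x \<le> F" if "x \<in> topspace X" for x
    using that by (intro filter_leI) (simp add: ev_\<phi> C_all)
  have \<phi>_K: "\<phi> x \<in> K_filter F" if "x \<in> topspace X" for x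
    using that \<phi>_u \<phi>_le by (simp add: K_filter_def topspace_beta_omega)
  have K_sub: "K_filter F \<subseteq> topspace omega_star"
    using K_filter_eq[OF F_le] by blast
  have \<phi>_cont: "continuous_map X omega_star \<phi>"
  proof (rule continuous_map_into_omega_star)
    show "\<phi> x \<in> topspace omega_star" if "x \<in> topspace X" for x
      using \<phi>_K[OF that] K_sub by blast
    have "{x \<in> topspace X. eventually P (\<phi> x)} = C P" for P
      using openin_subset[OF open_C[of P]] by (auto simp: ev_\<phi>)
    then show "openin X {x \<in> topspace X. eventually P (\<phi> x)}" for P
      using open_C by simp
  qed

  have C_clopen: "\<exists>P. C P = B" if B: "openin X B" "closedin X B" for B
  proof -
    \<comment> \<open>On each piece, \<open>e\<close> carries the traces of \<open>B\<close> and of its complement to disjoint compact sets.\<close>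
    have "\<exists>P. \<forall>z\<in>V i. eventually P (e z) \<longleftrightarrow> g i z \<in> B" for i
    proof -
      let ?S = "V i \<inter> {z \<in> topspace X. g i z \<in> B}" and ?T = "V i \<inter> {z \<in> topspace X. g i z \<in> topspace X - B}"
      have "closedin X (topspace X - B)" using B(1) by blast
      then have "closedin X ?T"
        by (intro closedin_Int V(2) closedin_continuous_map_preimage[OF g(1)])
      moreover have "closedin X ?S"
        using B(2) by (intro closedin_Int V(2) closedin_continuous_map_preimage[OF g(1)])
      ultimately have compact: "compactin omega_star (e ` ?S)" "compactin omega_star (e ` ?T)"
        using image_compactin[OF closedin_compact_space[OF X(2)] e(1)] by blast+
      have closed: "closedin omega_star (e ` ?T)"
        using Hausdorff_space_omega_star compact(2) by (rule compactin_imp_closedin)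
      have "e ` ?S \<inter> e ` ?T = {}"
        using e(2) by (auto simp: inj_on_def)
      with compact(1) closed obtain P
        where P: "\<And>p. p \<in> e ` ?S \<Longrightarrow> eventually P p" "\<And>p. p \<in> e ` ?T \<Longrightarrow> \<not> eventually P p"
        by (rule separate_compactin_closedin_omega_star) blast
      have "eventually P (e z) \<longleftrightarrow> g i z \<in> B" if z: "z \<in> V i" for z
      proof (cases "g i z \<in> B")
        case True
        then have "z \<in> ?S" using z V_sub by blast
        then show ?thesis using P(1) True by blast
      next
        case False
        moreover have "g i z \<in> topspace X"
          using z V_sub continuous_map_funspace[OF g(1)[of i]] by blast
        ultimately have "z \<in> ?T" using z V_sub by blast
        then show ?thesis using P(2) False by blast
      qed
      then show ?thesis by blast
    qed
    then obtain P where P: "\<And>i z. z \<in> V i \<Longrightarrow> eventually (P i) (e z) \<longleftrightarrow> g i z \<in> B"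
      by metis
    define Q where "Q x \<longleftrightarrow> (\<exists>i n. x = enc (i, n) \<and> P i n)" for x
    have Q_enc: "Q (enc (i, n)) \<longleftrightarrow> P i n" for i n by (auto simp: Q_def inj)
    have "x \<in> W Q \<longleftrightarrow> x \<in> B" if "x \<in> U" for x
      using that P unfolding U_def by (auto simp: W_iff Q_enc)
    then have "W Q = B \<inter> U" using W_sub by blast
    moreover have "X closure_of (B \<inter> U) = B"
      using extremally_disconnected_closure_of_Int[OF X(3) B(1) open_U] dense
        closure_of_closedin[OF B(2)] openin_subset[OF B(1)] by (auto simp: U_def)
    ultimately have "C Q = B" by (simp add: C_def)
    then show ?thesis by (rule exI[of _ Q])
  qed
  have \<phi>_inj: "inj_on \<phi> (topspace X)"
  proof (rule inj_onI, rule ccontr)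
    fix x y assume xy: "x \<in> topspace X" "y \<in> topspace X" "\<phi> x = \<phi> y" "x \<noteq> y"
    then obtain A B where AB: "openin X A" "openin X B" "x \<in> A" "y \<in> B" "disjnt A B"
      using X(1) unfolding Hausdorff_space_def by blast
    \<comment> \<open>The closure of \<open>A\<close> is a clopen set that separates \<open>x\<close> from \<open>y\<close>.\<close>
    obtain P where P: "C P = X closure_of A"
      using C_clopen[of "X closure_of A"] X(3) AB(1)
      unfolding extremally_disconnected_space_def by auto
    have "x \<in> X closure_of A"
      using closure_of_subset[OF openin_subset[OF AB(1)]] AB(3) by blast
    moreover have "y \<notin> X closure_of A"
      using openin_Int_closure_of_eq_empty[OF AB(2), of A] AB(4,5) by (auto simp: disjnt_def)
    ultimately show False
      using ev_\<phi>[OF xy(1), of P] ev_\<phi>[OF xy(2), of P] P xy(3) by simp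
  qed
  have \<phi>_onto: "\<phi> ` topspace X = K_filter F"
  proof
    show "\<phi> ` topspace X \<subseteq> K_filter F" using \<phi>_K by blast
    show "K_filter F \<subseteq> \<phi> ` topspace X"
    proof (rule subsetI, rule ccontr)
      fix p assume p: "p \<in> K_filter F" "p \<notin> \<phi> ` topspace X"
      have up: "ultrafilter p" and p_le: "p \<le> F"
        using p(1) by (auto simp: K_filter_def topspace_beta_omega)
      have "compactin omega_star (\<phi> ` topspace X)"
        using image_compactin[OF _ \<phi>_cont] X(2) by (simp add: compact_space_def)
      moreover have "closedin omega_star {p}"
        using p(1) K_sub Hausdorff_space_omega_star by (simp add: closedin_Hausdorff_singleton subset_iff)
      moreover have "\<phi> ` topspace X \<inter> {p} = {}" using p(2) by blast
      ultimately obtain P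
        where P: "\<And>q. q \<in> \<phi> ` topspace X \<Longrightarrow> eventually P q" "\<And>q. q \<in> {p} \<Longrightarrow> \<not> eventually P q"
        by (rule separate_compactin_closedin_omega_star) blast
      \<comment> \<open>Then \<open>W\<close> of the complement of \<open>P\<close> is empty, so \<open>P\<close> belongs to \<open>F\<close>.\<close>
      have "C P = topspace X"
        using P(1) ev_\<phi> openin_subset[OF open_C[of P]] by blast
      then have "C (\<lambda>n. \<not> P n) = {}"
        using C_Int[of P "\<lambda>n. \<not> P n"] C_False openin_subset[OF open_C[of "\<lambda>n. \<not> P n"]] by auto
      then have "W (\<lambda>n. \<not> P n) = {}"
        using closure_of_subset[OF openin_subset[OF open_W]] by (auto simp: C_def)
      then have "U \<subseteq> W P" using W_compl[of P] by blast
      then have "eventually P F"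
        unfolding F_def eventually_sum_filter U_def by (auto simp: eventually_Sup W_iff[symmetric])
      then have "eventually P p" using p_le by (rule filter_leD[rotated])
      then show False using P(2) by blast
    qed
  qed
  have "homeomorphic_map X (subtopology omega_star (K_filter F)) \<phi>"
  proof (rule continuous_imp_homeomorphic_map)
    show "continuous_map X (subtopology omega_star (K_filter F)) \<phi>"
      using \<phi>_cont \<phi>_onto by (auto simp: continuous_map_in_subtopology)
    show "Hausdorff_space (subtopology omega_star (K_filter F))"
      using Hausdorff_space_omega_star by (rule Hausdorff_space_subtopology)
    show "\<phi> ` topspace X = topspace (subtopology omega_star (K_filter F))"
      using \<phi>_onto K_sub by (simp add: Int_absorb1)
  qed (use X \<phi>_inj in auto)
  then show ?thesis
    unfolding F_def[symmetric]
    by (metis homeomorphic_map_imp_homeomorphic_space homeomorphic_space_sym)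
qed


section \<open>The shift\<close>

theorem theorem4p1:
  fixes X :: "'a topology"
  assumes "Hausdorff_space X"
    and "compact_space X"
    and "extremally_disconnected_space X"
    and "embeds_as_weak_P_set X omega_star"
    and "\<exists>Y. Y \<subset> topspace X \<and> openin X Y \<and> closedin X Y \<and> subtopology X Y homeomorphic_space X"
  shows "\<exists>F :: nat filter. F \<le> cofinite \<and> \<not> reversible_filter F \<and>
           weak_P_set omega_star (K_filter F) \<and>
           subtopology omega_star (K_filter F) homeomorphic_space X"
proof -
  obtain Y where Y: "Y \<subset> topspace X" "openin X Y" "closedin X Y" "subtopology X Y homeomorphic_space X"
    using assms(5) by blast
  obtain h where h: "homeomorphic_map X (subtopology X Y) h"
    using Y(4) homeomorphic_space homeomorphic_space_sym by blast
  have h_cont: "continuous_map X X h"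
    using homeomorphic_imp_continuous_map[OF h] by (simp add: continuous_map_in_subtopology)
  have h_inj: "inj_on h (topspace X)"
    using h by (simp add: homeomorphic_eq_everything_map)
  have h_img: "h ` topspace X = Y"
    using homeomorphic_imp_surjective_map[OF h] Y(1) by auto
  have h_open: "open_map X X h"
    using homeomorphic_imp_open_map[OF h] Y(2) by (auto simp: open_map_def openin_open_subtopology)
  have pow_cont: "continuous_map X X (h ^^ k)" for k
  proof (induction k)
    case (Suc k)
    then show ?case using continuous_map_compose[OF _ h_cont] by (simp add: o_def)
  qed (simp add: id_def)
  have pow_open: "open_map X X (h ^^ k)" for k
  proof (induction k)
    case (Suc k)
    then show ?case using open_map_compose[OF _ h_open] by (simp add: o_def)
  qed (simp add: open_map_def)
  have pow_in: "(h ^^ k) x \<in> topspace X" if "x \<in> topspace X" for k x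
    using continuous_map_funspace[OF pow_cont[of k]] that by blast
  have pow_inj: "inj_on (h ^^ k) (topspace X)" for k
  proof (induction k)
    case (Suc k)
    then show ?case
      using h_inj pow_in by (simp add: inj_on_def)
  qed simp

  obtain e where e: "embedding_map X omega_star e" "weak_P_set omega_star (e ` topspace X)"
    using assms(4) by (auto simp: embeds_as_weak_P_set_def)
  have e_cont: "continuous_map X omega_star e"
    using e(1) by (metis embedding_map_def homeomorphic_imp_continuous_map continuous_map_in_subtopology)
  have e_inj: "inj_on e (topspace X)"
    using e(1) by (auto simp: embedding_map_def homeomorphic_eq_everything_map)
  have e_top: "e x \<in> topspace omega_star" if "x \<in> topspace X" for x
    using continuous_map_funspace[OF e_cont] that by blast
  have e_compact: "compactin omega_star (e ` S)" if "closedin X S" for S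
    using image_compactin[OF closedin_compact_space[OF assms(2) that] e_cont] .

  define Z where "Z = topspace X - Y"
  have Z: "openin X Z" "closedin X Z" "Z \<noteq> {}"
    using Y by (auto simp: Z_def)
  have pow_open_Z: "openin X ((h ^^ k) ` Z)" for k
    using pow_open Z(1) by (simp add: open_map_def)
  have pow_disj: "(h ^^ k) ` Z \<inter> (h ^^ l) ` Z = {}" if "k < l" for k l
  proof -
    have False if z: "z \<in> Z" "w \<in> Z" "(h ^^ k) z = (h ^^ l) w" for z w
    proof -
      obtain m where m: "l = k + Suc m" using \<open>k < l\<close> less_iff_Suc_add by auto
      have zw: "z \<in> topspace X" "w \<in> topspace X" using z by (auto simp: Z_def)
      have "(h ^^ k) z = (h ^^ k) ((h ^^ Suc m) w)"
        using z(3) by (simp only: m funpow_add o_apply)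
      then have "z = h ((h ^^ m) w)"
        using inj_onD[OF pow_inj[of k]] zw pow_in[of w "Suc m"] by auto
      then have "z \<in> Y" using h_img pow_in[OF zw(2)] by blast
      then show False using z by (simp add: Z_def)
    qed
    then show ?thesis by blast
  qed
  define U where "U = (\<Union>k. (h ^^ k) ` Z)"
  have open_U: "openin X U" using pow_open_Z by (auto simp: U_def)
  define R where "R = topspace X - X closure_of U"
  have R: "openin X R" "closedin X R"
    using assms(3) open_U by (auto simp: R_def extremally_disconnected_space_def)
  have R_disj: "R \<inter> U = {}"
    using closure_of_subset[OF openin_subset[OF open_U]] by (auto simp: R_def)

  \<comment> \<open>The copy \<open>None\<close> takes \<open>R\<close>, which the shift leaves in place. The negative copies carry nothing:
      the shift moves one of them onto the copy \<open>Some 0\<close> and so is not open at the added point.\<close>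
  define V where "V i = (case i of None \<Rightarrow> R | Some k \<Rightarrow> if k \<ge> 0 then Z else {})" for i :: "int option"
  define g where "g i = (case i of None \<Rightarrow> id | Some k \<Rightarrow> h ^^ nat k)" for i :: "int option"
  have V: "openin X (V i)" "closedin X (V i)" for i
    using R Z by (auto simp: V_def split: option.split)
  have g: "continuous_map X X (g i)" "open_map X X (g i)" "inj_on (g i) (topspace X)" for i
    using pow_cont pow_open pow_inj by (auto simp: g_def id_def open_map_def split: option.split)
  have gV_Some: "g (Some k) ` V (Some k) \<subseteq> U" for k
    by (auto simp: g_def V_def U_def)
  have gV_None: "g None ` V None = R"
    by (simp add: g_def V_def)
  have disj: "g i ` V i \<inter> g j ` V j = {}" if "i \<noteq> j" for i j
  proof (cases i; cases j)
    fix k l assume "i = Some k" "j = Some l"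
    then show ?thesis
      using that pow_disj[of "nat k" "nat l"] pow_disj[of "nat l" "nat k"]
      by (cases "nat k < nat l"; cases "nat l < nat k") (auto simp: g_def V_def)
  qed (use that gV_Some gV_None R_disj in blast)+
  have gV_UN: "(\<Union>i. g i ` V i) = R \<union> U"
  proof
    show "(\<Union>i. g i ` V i) \<subseteq> R \<union> U"
    proof (intro UN_least)
      fix i
      show "g i ` V i \<subseteq> R \<union> U"
        using gV_Some gV_None by (cases i) auto
    qed
    have "(h ^^ k) ` Z = g (Some (int k)) ` V (Some (int k))" for k
      by (simp add: g_def V_def)
    then show "R \<union> U \<subseteq> (\<Union>i. g i ` V i)"
      unfolding U_def gV_None[symmetric] by blast
  qed
  have "topspace X \<subseteq> X closure_of (R \<union> U)"
    using closure_of_subset[OF openin_subset[OF R(1)]] by (auto simp: closure_of_Un R_def)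
  then have dense: "X closure_of (\<Union>i. g i ` V i) = topspace X"
    unfolding gV_UN by (simp add: closure_of_subset_topspace subset_antisym)

  define enc :: "int option \<times> nat \<Rightarrow> nat" where "enc = to_nat_on UNIV"
  have enc: "bij enc"
    unfolding enc_def by (intro to_nat_on_infinite) (simp_all add: finite_prod)
  define F where "F = sum_filter enc (\<lambda>i. Sup (e ` V i))"
  have V_sub: "e ` V i \<subseteq> topspace omega_star" for i
    using e_top openin_subset[OF V(1)[of i]] by blast
  have sep: "countably_separated (e ` V i)" for i
  proof (rule countably_separated_part)
    have "e ` V i \<union> e ` (topspace X - V i) = e ` topspace X"
      using openin_subset[OF V(1)[of i]] by blast
    then show "countably_separated (e ` V i \<union> e ` (topspace X - V i))"
      using countably_separated_weak_P_set[OF e_compact e(2)] by simp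
    show "e ` V i \<inter> e ` (topspace X - V i) = {}"
      using e_inj openin_subset[OF V(1)[of i]] by (auto simp: inj_on_def)
    show "compactin omega_star (e ` V i)" "compactin omega_star (e ` (topspace X - V i))"
      using V[of i] by (auto intro!: e_compact)
  qed
  have "F \<le> cofinite"
    unfolding F_def
    by (intro sum_filter_le_cofinite bij_is_inj[OF enc] Sup_least)
      (use V_sub in \<open>auto simp: topspace_omega_star\<close>)
  moreover have "weak_P_set omega_star (K_filter F)"
    unfolding F_def by (rule weak_P_set_sum_filter[OF enc V_sub sep])
  moreover have "subtopology omega_star (K_filter F) homeomorphic_space X"
    unfolding F_def
    by (rule homeomorphic_space_K_sum_filter[OF assms(1-3) e_cont e_inj enc V g disj dense])
  moreover have "\<not> reversible_filter F"
    unfolding F_def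
  proof (rule not_reversible_sum_filter[OF enc, of "map_option (\<lambda>k. k + 1)" _ "Some (- 1)"])
    have "bij (\<lambda>k::int. k + 1)" by (rule bij_plus_right)
    then show "bij (map_option (\<lambda>k::int. k + 1))"
      by (intro o_bij[of "map_option (\<lambda>k. k - 1)"]) (auto simp: option.map_comp o_def option.map_ident)
    show "Sup (e ` V i) \<le> Sup (e ` V (map_option (\<lambda>k. k + 1) i))" for i
      by (intro Sup_subset_mono image_mono) (auto simp: V_def split: option.split)
    show "Sup (e ` V (Some (- 1))) = bot" by (simp add: V_def)
    show "Sup (e ` V (map_option (\<lambda>k. k + 1) (Some (- 1)))) \<noteq> bot"
    proof -
      obtain z where z: "z \<in> Z" using Z(3) by blast
      then have "ultrafilter (e z)"
        using e_top[of z] by (simp add: Z_def topspace_omega_star)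
      then have "e z \<noteq> bot" by (simp add: ultrafilter_def)
      moreover have "z \<in> V (Some 0)" using z by (simp add: V_def)
      ultimately show ?thesis by auto
    qed
  qed
  ultimately show ?thesis by blast
qed

end
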